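(* Let $\mathcal{G}$ be a groupoid and let $R$ be a $\mathcal{G}$-graded ring. The following are equivalent: (i) the ring $R$ is object unital; (ii) for all finite subsets $E$ of $\mathcal{G}_0$ the ring $R_{\mathcal{G}(E)}$ is unital. In that case, if $E$ is a finite subset of $\mathcal{G}_0$, then $1_{R_{\mathcal{G}(E)}}=\sum_{e\in E}1_{R_e}$.
   Context: Rings are associative but not necessarily unital (the zero ring counts as unital). A groupoid $\mathcal{G}$ is a small category in which every morphism is an isomorphism, identified with its set of morphisms; $d(\sigma)=\sigma^{-1}\sigma$, $r(\sigma)=\sigma\sigma^{-1}$; $\mathcal{G}_0$ is the set of identity elements; $\sigma\tau$ is defined iff $d(\sigma)=r(\tau)$; $\mathcal{G}_2$ is the set of composable pairs. A ring $R$ is $\mathcal{G}$-graded if $R=\bigoplus_{\sigma\in\mathcal{G}}R_\sigma$ for additive subgroups $R_\sigma$ with $R_\sigma R_\tau\subseteq R_{\sigma\tau}$ if $(\sigma,\tau)\in\mathcal{G}_2$ and $R_\sigma R_\tau=\{0\}$ otherwise. It is object unital if each ring $R_e$, $e\in\mathcal{G}_0$, is unital and $1_{R_{r(\sigma)}}x=x1_{R_{d(\sigma)}}=x$ for all $\sigma\in\mathcal{G}$ and $x\in R_\sigma$. For $E\subseteq\mathcal{G}_0$, $\mathcal{G}(E)=\{\sigma\in\mathcal{G}\mid d(\sigma)\in E,\ r(\sigma)\in E\}$, and for $X\subseteq\mathcal{G}$, $R_X=\bigoplus_{x\in X}R_x$. *)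

theory Defs
  imports Main
begin

text \<open>
  A small category is identified with its set of arrows; objects are identified with
  identity arrows, so \<open>src\<close> and \<open>tgt\<close> (the maps \<open>d\<close> and \<open>r\<close>) take arrows to arrows.
  The composite \<open>\<sigma> \<cdot> \<tau>\<close> is meaningful iff \<open>src \<sigma> = tgt \<tau>\<close>; its value is unspecified otherwise.
\<close>

record 'g arrow_structure =
  arr :: "'g set"
  src :: "'g \<Rightarrow> 'g"
  tgt :: "'g \<Rightarrow> 'g"
  cmp :: "'g \<Rightarrow> 'g \<Rightarrow> 'g" (infixl "\<cdot>\<index>" 70)

definition composable :: "'g arrow_structure \<Rightarrow> 'g \<Rightarrow> 'g \<Rightarrow> bool" where
  "composable G \<sigma> \<tau> \<longleftrightarrow> \<sigma> \<in> arr G \<and> \<tau> \<in> arr G \<and> src G \<sigma> = tgt G \<tau>"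

definition small_category :: "'g arrow_structure \<Rightarrow> bool" where
  "small_category G \<longleftrightarrow>
     (\<forall>\<sigma>\<in>arr G. src G \<sigma> \<in> arr G \<and> tgt G \<sigma> \<in> arr G) \<and>
     (\<forall>\<sigma>\<in>arr G. src G (src G \<sigma>) = src G \<sigma> \<and> tgt G (src G \<sigma>) = src G \<sigma> \<and>
                src G (tgt G \<sigma>) = tgt G \<sigma> \<and> tgt G (tgt G \<sigma>) = tgt G \<sigma>) \<and>
     (\<forall>\<sigma> \<tau>. composable G \<sigma> \<tau> \<longrightarrow>
        \<sigma> \<cdot>\<^bsub>G\<^esub> \<tau> \<in> arr G \<and> src G (\<sigma> \<cdot>\<^bsub>G\<^esub> \<tau>) = src G \<tau> \<and> tgt G (\<sigma> \<cdot>\<^bsub>G\<^esub> \<tau>) = tgt G \<sigma>) \<and>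
     (\<forall>\<sigma> \<tau> \<rho>. composable G \<sigma> \<tau> \<and> composable G \<tau> \<rho> \<longrightarrow>
        (\<sigma> \<cdot>\<^bsub>G\<^esub> \<tau>) \<cdot>\<^bsub>G\<^esub> \<rho> = \<sigma> \<cdot>\<^bsub>G\<^esub> (\<tau> \<cdot>\<^bsub>G\<^esub> \<rho>)) \<and>
     (\<forall>\<sigma>\<in>arr G. tgt G \<sigma> \<cdot>\<^bsub>G\<^esub> \<sigma> = \<sigma> \<and> \<sigma> \<cdot>\<^bsub>G\<^esub> src G \<sigma> = \<sigma>)"

text \<open>
  The equations say exactly that \<open>d(\<sigma>) = \<sigma>\<^sup>-\<^sup>1\<sigma>\<close> and \<open>r(\<sigma>) = \<sigma>\<sigma>\<^sup>-\<^sup>1\<close>.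
\<close>

definition is_inverse :: "'g arrow_structure \<Rightarrow> 'g \<Rightarrow> 'g \<Rightarrow> bool" where
  "is_inverse G \<sigma> \<tau> \<longleftrightarrow> composable G \<sigma> \<tau> \<and> composable G \<tau> \<sigma> \<and>
     src G \<sigma> = \<tau> \<cdot>\<^bsub>G\<^esub> \<sigma> \<and> tgt G \<sigma> = \<sigma> \<cdot>\<^bsub>G\<^esub> \<tau>"

definition groupoid :: "'g arrow_structure \<Rightarrow> bool" where
  "groupoid G \<longleftrightarrow> small_category G \<and> (\<forall>\<sigma>\<in>arr G. \<exists>\<tau>. is_inverse G \<sigma> \<tau>)"

definition identities :: "'g arrow_structure \<Rightarrow> 'g set" where
  "identities G = src G ` arr G"

lemma identities_iff:
  "small_category G \<Longrightarrow> e \<in> identities G \<longleftrightarrow> e \<in> arr G \<and> src G e = e \<and> tgt G e = e"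
  by (auto simp: identities_def small_category_def image_iff) metis

definition full_on :: "'g arrow_structure \<Rightarrow> 'g set \<Rightarrow> 'g set" where
  "full_on G E = {\<sigma> \<in> arr G. src G \<sigma> \<in> E \<and> tgt G \<sigma> \<in> E}"

text \<open>
  The type class \<^class>\<open>ring\<close> is that of associative, not necessarily unital rings (the zero
  ring included); subrings are sets of elements.
\<close>

definition additive_subgroup :: "'r::ring set \<Rightarrow> bool" where
  "additive_subgroup A \<longleftrightarrow> 0 \<in> A \<and> (\<forall>x\<in>A. \<forall>y\<in>A. x - y \<in> A)"

definition nonunital_subring :: "'r::ring set \<Rightarrow> bool" where
  "nonunital_subring A \<longleftrightarrow> additive_subgroup A \<and> (\<forall>x\<in>A. \<forall>y\<in>A. x * y \<in> A)"

definition is_unity :: "'r::ring set \<Rightarrow> 'r \<Rightarrow> bool" where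
  "is_unity A u \<longleftrightarrow> u \<in> A \<and> (\<forall>x\<in>A. u * x = x \<and> x * u = x)"

definition unital :: "'r::ring set \<Rightarrow> bool" where
  "unital A \<longleftrightarrow> nonunital_subring A \<and> (\<exists>u. is_unity A u)"

definition unity :: "'r::ring set \<Rightarrow> 'r" where
  "unity A = (THE u. is_unity A u)"

lemma is_unity_unique: "is_unity A u \<Longrightarrow> is_unity A v \<Longrightarrow> u = v"
  unfolding is_unity_def by metis

lemma unity_eq: "is_unity A u \<Longrightarrow> unity A = u"
  unfolding unity_def by (blast intro: is_unity_unique)

text \<open>
  \<open>families R X\<close> is the external direct sum of the groups \<open>R \<sigma>\<close>, \<open>\<sigma> \<in> X\<close>, its elements being
  extended by zero outside \<open>X\<close>.
\<close>

definition families :: "('g \<Rightarrow> 'r::ring set) \<Rightarrow> 'g set \<Rightarrow> ('g \<Rightarrow> 'r) set" where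
  "families R X = {f. (\<forall>\<sigma>\<in>X. f \<sigma> \<in> R \<sigma>) \<and> (\<forall>\<sigma>. \<sigma> \<notin> X \<longrightarrow> f \<sigma> = 0) \<and> finite {\<sigma>. f \<sigma> \<noteq> 0}}"

definition total :: "('g \<Rightarrow> 'r::ring) \<Rightarrow> 'r" where
  "total f = (\<Sum>\<sigma> | f \<sigma> \<noteq> 0. f \<sigma>)"

text \<open>
  The set \<open>R\<^sub>X\<close>. When \<open>R\<close> is a grading by a groupoid \<open>G\<close> and \<open>X \<subseteq> arr G\<close>, the sum is direct,
  because \<open>total\<close> is injective on \<open>families R (arr G)\<close>.
\<close>

definition part :: "('g \<Rightarrow> 'r::ring set) \<Rightarrow> 'g set \<Rightarrow> 'r set" where
  "part R X = total ` families R X"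

definition graded :: "'g arrow_structure \<Rightarrow> ('g \<Rightarrow> 'r::ring set) \<Rightarrow> bool" where
  "graded G R \<longleftrightarrow>
     (\<forall>\<sigma>\<in>arr G. additive_subgroup (R \<sigma>)) \<and>
     bij_betw total (families R (arr G)) UNIV \<and>
     (\<forall>\<sigma>\<in>arr G. \<forall>\<tau>\<in>arr G. \<forall>x\<in>R \<sigma>. \<forall>y\<in>R \<tau>.
        if composable G \<sigma> \<tau> then x * y \<in> R (\<sigma> \<cdot>\<^bsub>G\<^esub> \<tau>) else x * y = 0)"

definition object_unital :: "'g arrow_structure \<Rightarrow> ('g \<Rightarrow> 'r::ring set) \<Rightarrow> bool" where
  "object_unital G R \<longleftrightarrow>
     (\<forall>e\<in>identities G. unital (R e)) \<and>
     (\<forall>\<sigma>\<in>arr G. \<forall>x\<in>R \<sigma>. unity (R (tgt G \<sigma>)) * x = x \<and> x * unity (R (src G \<sigma>)) = x)"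

end

theory Submission
  imports Defs
begin

text \<open>
  The sum of the local units \<open>1\<^bsub>R\<^sub>e\<^esub>\<close>, \<open>e \<in> E\<close>, acts as a unity on homogeneous elements, since only
  the unit at the target (source) survives. Conversely, let \<open>u\<close> be the unity of the part over
  \<open>{src \<sigma>, tgt \<sigma>}\<close> and \<open>x \<in> R \<sigma>\<close>. By cancellation, taking degree-\<open>\<sigma>\<close> components in \<open>u x = x\<close>
  and \<open>x u = x\<close> leaves \<open>u\<^bsub>tgt \<sigma>\<^esub> x = x\<close> and \<open>x u\<^bsub>src \<sigma>\<^esub> = x\<close>, so the identity components of \<open>u\<close>
  are the required local units.
\<close>

section \<open>Additive subgroups and finitely supported families\<close>

lemma additive_subgroup_add:
  assumes "additive_subgroup A" "x \<in> A" "y \<in> A"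
  shows "x + y \<in> A"
proof -
  \<comment> \<open>Subgroups are axiomatised by differences, so the sum is reached as
    \<open>x - (0 - y)\<close>.\<close>
  have "0 - y \<in> A" using assms unfolding additive_subgroup_def by blast
  then have "x - (0 - y) \<in> A" using assms unfolding additive_subgroup_def by blast
  then show ?thesis by simp
qed

lemma additive_subgroup_sum:
  assumes "additive_subgroup A" "\<And>i. i \<in> I \<Longrightarrow> f i \<in> A"
  shows "sum f I \<in> A"
  using assms(2)
proof (induction I rule: infinite_finite_induct)
  case (insert i I)
  then show ?case using additive_subgroup_add[OF assms(1)] by simp
qed (use assms(1) in \<open>simp_all add: additive_subgroup_def\<close>)

text \<open>Terms outside the support are zero. This lets the totals of several families be compared
  over one common finite index set.\<close>

lemma total_superset:
  assumes "finite S" "\<And>\<sigma>. f \<sigma> \<noteq> 0 \<Longrightarrow> \<sigma> \<in> S"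
  shows "total f = sum f S"
  unfolding total_def using assms by (intro sum.mono_neutral_left) auto

lemma total_diff:
  assumes "f \<in> families R X" "g \<in> families R X"
  shows "total (\<lambda>\<sigma>. f \<sigma> - g \<sigma>) = total f - total g"
proof -
  let ?S = "{\<sigma>. f \<sigma> \<noteq> 0} \<union> {\<sigma>. g \<sigma> \<noteq> 0}"
  have fin: "finite ?S" using assms by (simp add: families_def)
  have "total (\<lambda>\<sigma>. f \<sigma> - g \<sigma>) = (\<Sum>\<sigma>\<in>?S. f \<sigma> - g \<sigma>)"
    using fin by (rule total_superset) auto
  moreover have "total f = sum f ?S" "total g = sum g ?S"
    using fin by (auto intro: total_superset)
  ultimately show ?thesis by (simp add: sum_subtractf)
qed

lemma families_diff:
  assumes "\<And>\<sigma>. \<sigma> \<in> X \<Longrightarrow> additive_subgroup (R \<sigma>)" "f \<in> families R X" "g \<in> families R X"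
  shows "(\<lambda>\<sigma>. f \<sigma> - g \<sigma>) \<in> families R X"
proof -
  have "finite {\<sigma>. f \<sigma> - g \<sigma> \<noteq> 0}"
    by (rule finite_subset[of _ "{\<sigma>. f \<sigma> \<noteq> 0} \<union> {\<sigma>. g \<sigma> \<noteq> 0}"])
      (use assms in \<open>auto simp: families_def\<close>)
  then show ?thesis using assms by (auto simp: families_def additive_subgroup_def)
qed

text \<open>Together with \<open>total_single\<close>, this presents a homogeneous element as the
  total of a family concentrated in one degree.\<close>

lemma single_family:
  assumes "\<And>\<sigma>. \<sigma> \<in> X \<Longrightarrow> additive_subgroup (R \<sigma>)" "\<tau> \<in> X" "x \<in> R \<tau>"
  shows "(\<lambda>\<sigma>. if \<sigma> = \<tau> then x else 0) \<in> families R X"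
  using assms by (auto simp: families_def additive_subgroup_def)

lemma total_single: "total (\<lambda>\<sigma>. if \<sigma> = \<tau> then x else 0) = x"
  by (subst total_superset[of "{\<tau>}"]) (auto split: if_splits)

lemma part_additive_subgroup:
  fixes R :: "'g \<Rightarrow> 'r::ring set"
  assumes "\<And>\<sigma>. \<sigma> \<in> X \<Longrightarrow> additive_subgroup (R \<sigma>)"
  shows "additive_subgroup (part R X)"
  unfolding additive_subgroup_def
proof (intro conjI ballI)
  have "(\<lambda>_. 0) \<in> families R X"
    using assms by (simp add: families_def additive_subgroup_def)
  then have "total (\<lambda>_::'g. 0) \<in> part R X" unfolding part_def by (rule imageI)
  then show "0 \<in> part R X" by (simp add: total_def)
next
  fix x y assume "x \<in> part R X" "y \<in> part R X"
  then obtain f g where fg: "f \<in> families R X" "g \<in> families R X" and "x = total f" "y = total g"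
    unfolding part_def by blast
  then have "x - y = total (\<lambda>\<sigma>. f \<sigma> - g \<sigma>)" by (simp add: total_diff[OF fg])
  moreover have "(\<lambda>\<sigma>. f \<sigma> - g \<sigma>) \<in> families R X" using assms fg by (rule families_diff)
  ultimately show "x - y \<in> part R X" unfolding part_def by (rule image_eqI)
qed

lemma homogeneous_in_part:
  assumes "\<And>\<sigma>. \<sigma> \<in> X \<Longrightarrow> additive_subgroup (R \<sigma>)" "\<tau> \<in> X" "x \<in> R \<tau>"
  shows "x \<in> part R X"
proof -
  have "(\<lambda>\<sigma>. if \<sigma> = \<tau> then x else 0) \<in> families R X"
    using assms by (rule single_family)
  then have "total (\<lambda>\<sigma>. if \<sigma> = \<tau> then x else 0) \<in> part R X" unfolding part_def by (rule imageI)
  then show ?thesis by (simp add: total_single)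
qed

text \<open>\<open>S\<close> is the support of a representing family. Since \<open>f\<close> is also
  controlled on all of \<open>X\<close> and vanishes off \<open>S\<close>, later arguments may
  evaluate it at degrees that need not occur in the sum.\<close>

lemma part_decompose:
  assumes "x \<in> part R X"
  obtains S f where "finite S" "S \<subseteq> X" "\<And>\<sigma>. \<sigma> \<in> X \<Longrightarrow> f \<sigma> \<in> R \<sigma>"
    "\<And>\<sigma>. \<sigma> \<notin> S \<Longrightarrow> f \<sigma> = 0" "x = sum f S"
proof -
  obtain f where f: "f \<in> families R X" "x = total f" using assms unfolding part_def by blast
  show thesis
  proof (rule that)
    show "finite {\<sigma>. f \<sigma> \<noteq> 0}" "{\<sigma>. f \<sigma> \<noteq> 0} \<subseteq> X" using f(1) by (auto simp: families_def)
    show "f \<sigma> \<in> R \<sigma>" if "\<sigma> \<in> X" for \<sigma> using f(1) that by (simp add: families_def)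
    show "x = sum f {\<sigma>. f \<sigma> \<noteq> 0}" using f(2) by (simp add: total_def)
  qed simp
qed

section \<open>Homogeneous components of a graded ring\<close>

lemma graded_subgroup: "graded G R \<Longrightarrow> \<sigma> \<in> arr G \<Longrightarrow> additive_subgroup (R \<sigma>)"
  by (simp add: graded_def)

lemma graded_mult:
  "graded G R \<Longrightarrow> composable G \<sigma> \<tau> \<Longrightarrow> x \<in> R \<sigma> \<Longrightarrow> y \<in> R \<tau> \<Longrightarrow> x * y \<in> R (\<sigma> \<cdot>\<^bsub>G\<^esub> \<tau>)"
  unfolding graded_def composable_def by metis

lemma graded_mult_zero:
  "graded G R \<Longrightarrow> \<sigma> \<in> arr G \<Longrightarrow> \<tau> \<in> arr G \<Longrightarrow> src G \<sigma> \<noteq> tgt G \<tau> \<Longrightarrow> x \<in> R \<sigma> \<Longrightarrow> y \<in> R \<tau>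
    \<Longrightarrow> x * y = 0"
  unfolding graded_def composable_def by metis

text \<open>The coordinate of \<open>x\<close> in degree \<open>\<sigma>\<close>. For a grading,
  \<open>total\<close> is a bijection from the families over \<open>arr G\<close> onto the whole
  ring, so the inverse is meaningful at every \<open>x\<close>.\<close>

definition component :: "'g arrow_structure \<Rightarrow> ('g \<Rightarrow> 'r::ring set) \<Rightarrow> 'g \<Rightarrow> 'r \<Rightarrow> 'r" where
  "component G R \<sigma> x = the_inv_into (families R (arr G)) total x \<sigma>"

lemma component_total:
  assumes "graded G R" "f \<in> families R (arr G)"
  shows "component G R \<sigma> (total f) = f \<sigma>"
  using assms unfolding component_def graded_def bij_betw_def by (simp add: the_inv_into_f_f)

text \<open>Surjectivity of \<open>total\<close> supplies representing families,
  \<open>total\<close> respects differences, and injectivity reads off the coordinates.\<close>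

lemma component_diff:
  assumes "graded G R"
  shows "component G R \<sigma> (x - y) = component G R \<sigma> x - component G R \<sigma> y"
proof -
  have "x \<in> total ` families R (arr G)" "y \<in> total ` families R (arr G)"
    using assms by (auto simp: graded_def bij_betw_def)
  then obtain f g where fg: "f \<in> families R (arr G)" "g \<in> families R (arr G)"
    "x = total f" "y = total g" by blast
  have "(\<lambda>\<sigma>. f \<sigma> - g \<sigma>) \<in> families R (arr G)"
    using fg graded_subgroup[OF assms] by (intro families_diff)
  then show ?thesis
    using fg total_diff[OF fg(1,2)] component_total[OF assms] by metis
qed

lemma component_sum:
  assumes "graded G R"
  shows "component G R \<sigma> (sum f I) = (\<Sum>i\<in>I. component G R \<sigma> (f i))"
proof -
  have zero: "component G R \<sigma> 0 = 0" using component_diff[OF assms, of \<sigma> 0 0] by simp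
  have add: "component G R \<sigma> (x + y) = component G R \<sigma> x + component G R \<sigma> y" for x y
    using component_diff[OF assms, of \<sigma> "x + y" y] by (simp add: algebra_simps)
  show ?thesis by (induction I rule: infinite_finite_induct) (simp_all add: zero add)
qed

lemma component_homogeneous:
  assumes "graded G R" "\<tau> \<in> arr G" "x \<in> R \<tau>"
  shows "component G R \<sigma> x = (if \<sigma> = \<tau> then x else 0)"
  using component_total[OF assms(1) single_family[of "arr G" R, OF graded_subgroup[OF assms(1)]
      assms(2,3)]]
  by (simp add: total_single)

section \<open>Cancellation in groupoids\<close>

text \<open>Multiply \<open>\<rho> \<cdot> \<sigma> = \<sigma>\<close> on the right by an inverse of
  \<open>\<sigma>\<close>. This is where invertibility of the arrows enters.\<close>

lemma groupoid_right_cancel: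
  assumes "groupoid G" "composable G \<rho> \<sigma>" "\<rho> \<cdot>\<^bsub>G\<^esub> \<sigma> = \<sigma>"
  shows "\<rho> = tgt G \<sigma>"
proof -
  obtain \<tau> where \<tau>: "is_inverse G \<sigma> \<tau>" using assms by (auto simp: groupoid_def composable_def)
  have cat: "small_category G" using assms by (simp add: groupoid_def)
  have "\<rho> = \<rho> \<cdot>\<^bsub>G\<^esub> tgt G \<sigma>"
    using cat assms(2) unfolding small_category_def composable_def by metis
  also have "\<dots> = (\<rho> \<cdot>\<^bsub>G\<^esub> \<sigma>) \<cdot>\<^bsub>G\<^esub> \<tau>"
    using cat \<tau> assms(2) unfolding small_category_def is_inverse_def by metis
  also have "\<dots> = tgt G \<sigma>" using \<tau> assms(3) by (simp add: is_inverse_def)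
  finally show ?thesis .
qed

lemma groupoid_left_cancel:
  assumes "groupoid G" "composable G \<sigma> \<rho>" "\<sigma> \<cdot>\<^bsub>G\<^esub> \<rho> = \<sigma>"
  shows "\<rho> = src G \<sigma>"
proof -
  obtain \<tau> where \<tau>: "is_inverse G \<sigma> \<tau>" using assms by (auto simp: groupoid_def composable_def)
  have cat: "small_category G" using assms by (simp add: groupoid_def)
  have "\<rho> = src G \<sigma> \<cdot>\<^bsub>G\<^esub> \<rho>"
    using cat assms(2) unfolding small_category_def composable_def by metis
  also have "\<dots> = \<tau> \<cdot>\<^bsub>G\<^esub> (\<sigma> \<cdot>\<^bsub>G\<^esub> \<rho>)"
    using cat \<tau> assms(2) unfolding small_category_def is_inverse_def by metis
  also have "\<dots> = src G \<sigma>" using \<tau> assms(3) by (simp add: is_inverse_def)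
  finally show ?thesis .
qed

section \<open>Subrings of the graded ring\<close>

text \<open>Arrows with both ends in \<open>E\<close> are closed under composition. After expanding
  a product into homogeneous products, each term is either homogeneous of such a degree or
  zero.\<close>

lemma part_full_on_subring:
  assumes "groupoid G" "graded G R"
  shows "nonunital_subring (part R (full_on G E))"
  unfolding nonunital_subring_def
proof (intro conjI ballI)
  let ?X = "full_on G E"
  have sub: "additive_subgroup (R \<sigma>)" if "\<sigma> \<in> ?X" for \<sigma>
    using that graded_subgroup[OF assms(2)] by (simp add: full_on_def)
  show P: "additive_subgroup (part R ?X)" using sub by (rule part_additive_subgroup)
  fix x y assume "x \<in> part R ?X" "y \<in> part R ?X"
  obtain f S where f: "S \<subseteq> ?X" "\<And>\<sigma>. \<sigma> \<in> ?X \<Longrightarrow> f \<sigma> \<in> R \<sigma>" "x = sum f S"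
    using part_decompose[OF \<open>x \<in> _\<close>] by metis
  obtain g T where g: "T \<subseteq> ?X" "\<And>\<sigma>. \<sigma> \<in> ?X \<Longrightarrow> g \<sigma> \<in> R \<sigma>" "y = sum g T"
    using part_decompose[OF \<open>y \<in> _\<close>] by metis
  have "f \<sigma> * g \<tau> \<in> part R ?X" if "\<sigma> \<in> S" "\<tau> \<in> T" for \<sigma> \<tau>
  proof -
    have m: "\<sigma> \<in> ?X" "\<tau> \<in> ?X" using that f(1) g(1) by auto
    have fg: "f \<sigma> \<in> R \<sigma>" "g \<tau> \<in> R \<tau>" using m f(2) g(2) by auto
    show ?thesis
    proof (cases "composable G \<sigma> \<tau>")
      case True
      then have c: "\<sigma> \<cdot>\<^bsub>G\<^esub> \<tau> \<in> ?X"
        using m assms(1) by (auto simp: full_on_def groupoid_def small_category_def)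
      show ?thesis
        by (rule homogeneous_in_part[where R = R, OF _ c graded_mult[OF assms(2) True fg]]) (rule sub)
    next
      case False
      then have "f \<sigma> * g \<tau> = 0"
        using m graded_mult_zero[OF assms(2) _ _ _ fg] by (simp add: composable_def full_on_def)
      then show ?thesis using P by (simp add: additive_subgroup_def)
    qed
  qed
  then show "x * y \<in> part R ?X"
    unfolding f(3) g(3) sum_product by (intro additive_subgroup_sum[OF P])
qed

text \<open>An identity is idempotent, \<open>e \<cdot> e = e\<close>, so the grading condition
  keeps products inside \<open>R e\<close>.\<close>

lemma identity_component_subring:
  assumes "groupoid G" "graded G R" "e \<in> identities G"
  shows "nonunital_subring (R e)"
proof -
  have cat: "small_category G" using assms by (simp add: groupoid_def)
  then have e: "e \<in> arr G" "src G e = e" "tgt G e = e"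
    using assms(3) by (simp_all add: identities_iff)
  then have "composable G e e" "e \<cdot>\<^bsub>G\<^esub> e = e"
    using cat unfolding composable_def small_category_def by metis+
  then show ?thesis
    using graded_mult[OF assms(2), of e e] graded_subgroup[OF assms(2) e(1)]
    by (auto simp: nonunital_subring_def)
qed

lemma unity_is_unity: "unital A \<Longrightarrow> is_unity A (unity A)"
  unfolding unital_def using unity_eq by metis

section \<open>From local units to unital parts\<close>

lemma sum_local_units_is_unity:
  assumes "groupoid G" "graded G R" "object_unital G R" "finite E" "E \<subseteq> identities G"
  shows "is_unity (part R (full_on G E)) (\<Sum>e\<in>E. unity (R e))"
  unfolding is_unity_def
proof (intro conjI ballI)
  let ?X = "full_on G E" and ?u = "\<Sum>e\<in>E. unity (R e)"
  have cat: "small_category G" using assms by (simp add: groupoid_def)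
  have sub: "additive_subgroup (R \<sigma>)" if "\<sigma> \<in> ?X" for \<sigma>
    using that graded_subgroup[OF assms(2)] by (simp add: full_on_def)
  have E: "e \<in> arr G" "src G e = e" "tgt G e = e" "e \<in> ?X" if "e \<in> E" for e
  proof -
    have "e \<in> identities G" using that assms(5) by blast
    then show "e \<in> arr G" "src G e = e" "tgt G e = e"
      using cat by (simp_all add: identities_iff)
    then show "e \<in> ?X" using that by (simp add: full_on_def)
  qed
  have unit: "unity (R e) \<in> R e" if "e \<in> E" for e
    using unity_is_unity that assms(3,5) by (auto simp: object_unital_def is_unity_def)
  show "?u \<in> part R ?X"
  proof (rule additive_subgroup_sum[OF part_additive_subgroup[OF sub]])
    fix e assume "e \<in> E"
    show "unity (R e) \<in> part R ?X"
      by (rule homogeneous_in_part[where R = R, OF _ E(4) unit]) (use sub \<open>e \<in> E\<close> in auto)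
  qed
  fix x assume "x \<in> part R ?X"
  then obtain f S where f: "S \<subseteq> ?X" "\<And>\<sigma>. \<sigma> \<in> ?X \<Longrightarrow> f \<sigma> \<in> R \<sigma>" "x = sum f S"
    using part_decompose by metis
  have left: "?u * f \<sigma> = f \<sigma>" and right: "f \<sigma> * ?u = f \<sigma>" if "\<sigma> \<in> S" for \<sigma>
  proof -
    have \<sigma>: "\<sigma> \<in> arr G" "src G \<sigma> \<in> E" "tgt G \<sigma> \<in> E" "f \<sigma> \<in> R \<sigma>"
      using that f(1,2) by (auto simp: full_on_def)
    \<comment> \<open>An identity \<open>e\<close> composes with \<open>\<sigma>\<close> on the left
      only if \<open>e\<close> is the target of \<open>\<sigma>\<close>; every other local unit
      annihilates \<open>f \<sigma>\<close>.\<close>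
    have "unity (R e) * f \<sigma> = (if e = tgt G \<sigma> then f \<sigma> else 0)" if "e \<in> E" for e
      using \<sigma> assms(3) unit[OF that] E[OF that] graded_mult_zero[OF assms(2), of e \<sigma>]
      by (simp add: object_unital_def)
    then show "?u * f \<sigma> = f \<sigma>" using \<sigma> assms(4) by (simp add: sum_distrib_right)
    have "f \<sigma> * unity (R e) = (if e = src G \<sigma> then f \<sigma> else 0)" if "e \<in> E" for e
      using \<sigma> assms(3) unit[OF that] E[OF that] graded_mult_zero[OF assms(2), of \<sigma> e]
      by (auto simp: object_unital_def)
    then show "f \<sigma> * ?u = f \<sigma>" using \<sigma> assms(4) by (simp add: sum_distrib_left)
  qed
  show "?u * x = x" unfolding f(3) sum_distrib_left by (rule sum.cong[OF refl left])
  show "x * ?u = x" unfolding f(3) sum_distrib_right[of f] by (rule sum.cong[OF refl right])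
qed

section \<open>From unital parts to local units\<close>

lemma unity_components:
  assumes "groupoid G" "graded G R" "E \<subseteq> identities G" "is_unity (part R (full_on G E)) u"
  obtains v where "\<And>e. e \<in> E \<Longrightarrow> v e \<in> R e"
    "\<And>\<sigma> x. \<sigma> \<in> full_on G E \<Longrightarrow> x \<in> R \<sigma> \<Longrightarrow> v (tgt G \<sigma>) * x = x \<and> x * v (src G \<sigma>) = x"
proof -
  let ?X = "full_on G E"
  have cat: "small_category G" using assms by (simp add: groupoid_def)
  have sub: "additive_subgroup (R \<sigma>)" if "\<sigma> \<in> ?X" for \<sigma>
    using that graded_subgroup[OF assms(2)] by (simp add: full_on_def)
  have "u \<in> part R ?X" using assms(4) by (simp add: is_unity_def)
  then obtain S f where f: "finite S" "S \<subseteq> ?X" "\<And>\<sigma>. \<sigma> \<in> ?X \<Longrightarrow> f \<sigma> \<in> R \<sigma>"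
    "\<And>\<sigma>. \<sigma> \<notin> S \<Longrightarrow> f \<sigma> = 0" "u = sum f S"
    using part_decompose[of u R ?X] by metis
  show thesis
  \<comment> \<open>The witness is the family of homogeneous components of \<open>u\<close>.
    Components at non-identity arrows may be nonzero at this stage, but only those at identities are
    used as local units.\<close>
  proof (rule that[of f])
    fix e assume "e \<in> E"
    then have "e \<in> ?X" using assms(3) identities_iff[OF cat] by (auto simp: full_on_def)
    then show "f e \<in> R e" by (rule f(3))
  next
    fix \<sigma> x assume \<sigma>: "\<sigma> \<in> ?X" and x: "x \<in> R \<sigma>"
    have arr: "\<sigma> \<in> arr G" using \<sigma> by (simp add: full_on_def)
    have "x \<in> part R ?X" by (rule homogeneous_in_part[where R = R, OF _ \<sigma> x]) (rule sub)
    then have ux: "u * x = x" "x * u = x" using assms(4) unfolding is_unity_def by blast+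
    have \<rho>: "\<rho> \<in> arr G" "f \<rho> \<in> R \<rho>" if "\<rho> \<in> S" for \<rho>
      using f(2,3) that by (auto simp: full_on_def)
    have zero: "component G R \<sigma> 0 = 0" using component_diff[OF assms(2), of \<sigma> 0 0] by simp
    have compx: "component G R \<sigma> x = x" using component_homogeneous[OF assms(2) arr x] by simp
    \<comment> \<open>A product with \<open>\<rho>\<close> not composable vanishes. Otherwise its
      degree is \<open>\<rho> \<cdot> \<sigma>\<close>, which by cancellation equals
      \<open>\<sigma>\<close> exactly when \<open>\<rho>\<close> is the target of
      \<open>\<sigma>\<close>.\<close>
    have "component G R \<sigma> (f \<rho> * x) = (if \<rho> = tgt G \<sigma> then f \<rho> * x else 0)" if "\<rho> \<in> S" for \<rho>
    proof (cases "composable G \<rho> \<sigma>")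
      case True
      have "\<rho> \<cdot>\<^bsub>G\<^esub> \<sigma> \<in> arr G" using cat True by (simp add: small_category_def)
      moreover have "f \<rho> * x \<in> R (\<rho> \<cdot>\<^bsub>G\<^esub> \<sigma>)"
        by (rule graded_mult[OF assms(2) True \<rho>(2)[OF that] x])
      moreover have "\<rho> \<cdot>\<^bsub>G\<^esub> \<sigma> = \<sigma> \<longleftrightarrow> \<rho> = tgt G \<sigma>"
        using groupoid_right_cancel[OF assms(1) True] cat arr
        unfolding small_category_def by blast
      ultimately show ?thesis
        using component_homogeneous[OF assms(2), of "\<rho> \<cdot>\<^bsub>G\<^esub> \<sigma>" "f \<rho> * x" \<sigma>] by auto
    next
      case False
      have "f \<rho> * x = 0"
        using False \<rho>(1)[OF that] arr graded_mult_zero[OF assms(2) _ _ _ \<rho>(2)[OF that] x]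
        by (simp add: composable_def)
      then show ?thesis using zero by auto
    qed
    then have "(\<Sum>\<rho>\<in>S. if \<rho> = tgt G \<sigma> then f \<rho> * x else 0) = x"
      using compx ux(1) component_sum[OF assms(2), of \<sigma> "\<lambda>\<rho>. f \<rho> * x" S]
      by (simp add: f(5) sum_distrib_right)
    \<comment> \<open>If the target lies outside the support \<open>S\<close>, the sum is empty of
      nonzero terms, so \<open>x = 0\<close> and the equation still holds.\<close>
    then have left: "f (tgt G \<sigma>) * x = x"
      using f(1,4) by (cases "tgt G \<sigma> \<in> S") (simp_all add: sum.delta)
    have "component G R \<sigma> (x * f \<rho>) = (if \<rho> = src G \<sigma> then x * f \<rho> else 0)" if "\<rho> \<in> S" for \<rho>
    proof (cases "composable G \<sigma> \<rho>")
      case True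
      have "\<sigma> \<cdot>\<^bsub>G\<^esub> \<rho> \<in> arr G" using cat True by (simp add: small_category_def)
      moreover have "x * f \<rho> \<in> R (\<sigma> \<cdot>\<^bsub>G\<^esub> \<rho>)"
        by (rule graded_mult[OF assms(2) True x \<rho>(2)[OF that]])
      moreover have "\<sigma> \<cdot>\<^bsub>G\<^esub> \<rho> = \<sigma> \<longleftrightarrow> \<rho> = src G \<sigma>"
        using groupoid_left_cancel[OF assms(1) True] cat arr
        unfolding small_category_def by blast
      ultimately show ?thesis
        using component_homogeneous[OF assms(2), of "\<sigma> \<cdot>\<^bsub>G\<^esub> \<rho>" "x * f \<rho>" \<sigma>] by auto
    next
      case False
      have "x * f \<rho> = 0"
        using False \<rho>(1)[OF that] arr graded_mult_zero[OF assms(2) _ _ _ x \<rho>(2)[OF that]]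
        by (simp add: composable_def)
      then show ?thesis using zero by auto
    qed
    then have "(\<Sum>\<rho>\<in>S. if \<rho> = src G \<sigma> then x * f \<rho> else 0) = x"
      using compx ux(2) component_sum[OF assms(2), of \<sigma> "\<lambda>\<rho>. x * f \<rho>" S]
      by (simp add: f(5) sum_distrib_left)
    then have right: "x * f (src G \<sigma>) = x"
      using f(1,4) by (cases "src G \<sigma> \<in> S") (simp_all add: sum.delta)
    show "f (tgt G \<sigma>) * x = x \<and> x * f (src G \<sigma>) = x" using left right by simp
  qed
qed

text \<open>Applying \<open>unity_components\<close> with \<open>\<sigma> = e\<close> shows that
  \<open>v e\<close> is a unity of \<open>R e\<close>. By uniqueness it is
  \<open>unity (R e)\<close>, so the equations for \<open>v\<close> become those for the chosen
  unities.\<close>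

lemma local_units_if_parts_unital:
  assumes "groupoid G" "graded G R"
    and E: "E \<subseteq> identities G" "unital (part R (full_on G E))"
  shows "e \<in> E \<Longrightarrow> unital (R e)"
    and "\<sigma> \<in> full_on G E \<Longrightarrow> x \<in> R \<sigma>
      \<Longrightarrow> unity (R (tgt G \<sigma>)) * x = x \<and> x * unity (R (src G \<sigma>)) = x"
proof -
  have cat: "small_category G" using assms by (simp add: groupoid_def)
  obtain v where v: "\<And>e. e \<in> E \<Longrightarrow> v e \<in> R e"
    "\<And>\<sigma> x. \<sigma> \<in> full_on G E \<Longrightarrow> x \<in> R \<sigma> \<Longrightarrow> v (tgt G \<sigma>) * x = x \<and> x * v (src G \<sigma>) = x"
    using unity_components[OF assms(1,2) E(1) unity_is_unity[OF E(2)]] by blast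
  have unit: "is_unity (R e) (v e)" if "e \<in> E" for e
  proof -
    have e: "e \<in> full_on G E" "src G e = e" "tgt G e = e"
      using that E(1) identities_iff[OF cat] by (auto simp: full_on_def)
    then show ?thesis using v(1)[OF that] v(2)[OF e(1)] by (auto simp: is_unity_def)
  qed
  then show "e \<in> E \<Longrightarrow> unital (R e)"
    using identity_component_subring[OF assms(1,2)] E(1) by (auto simp: unital_def)
  show "\<sigma> \<in> full_on G E \<Longrightarrow> x \<in> R \<sigma>
      \<Longrightarrow> unity (R (tgt G \<sigma>)) * x = x \<and> x * unity (R (src G \<sigma>)) = x"
    using v(2) unity_eq[OF unit] by (auto simp: full_on_def)
qed

section \<open>The equivalence and the formula for the unity\<close>

theorem proposition5:
  fixes G :: "'g arrow_structure" and R :: "'g \<Rightarrow> 'r::ring set"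
  assumes "groupoid G" and "graded G R"
  shows "(object_unital G R \<longleftrightarrow>
            (\<forall>E. finite E \<and> E \<subseteq> identities G \<longrightarrow> unital (part R (full_on G E)))) \<and>
         (object_unital G R \<longrightarrow>
            (\<forall>E. finite E \<and> E \<subseteq> identities G \<longrightarrow>
               unity (part R (full_on G E)) = (\<Sum>e\<in>E. unity (R e))))"
proof (intro conjI iffI impI allI)
  \<comment> \<open>The implication from (i) to (ii) and the formula share their hypotheses, and
    both follow from the same explicit unity.\<close>
  fix E assume "object_unital G R" and "finite E \<and> E \<subseteq> identities G"
  then have u: "is_unity (part R (full_on G E)) (\<Sum>e\<in>E. unity (R e))"
    using sum_local_units_is_unity[OF assms] by blast
  then show "unital (part R (full_on G E))"
    using part_full_on_subring[OF assms] by (auto simp: unital_def)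
  show "unity (part R (full_on G E)) = (\<Sum>e\<in>E. unity (R e))" using u by (rule unity_eq)
next
  assume parts: "\<forall>E. finite E \<and> E \<subseteq> identities G \<longrightarrow> unital (part R (full_on G E))"
  have cat: "small_category G" using assms by (simp add: groupoid_def)
  show "object_unital G R"
    unfolding object_unital_def
  proof (intro conjI ballI)
    fix e assume "e \<in> identities G"
    then show "unital (R e)"
      using local_units_if_parts_unital(1)[OF assms, of "{e}"] parts by simp
  next
    fix \<sigma> x assume \<sigma>: "\<sigma> \<in> arr G" and x: "x \<in> R \<sigma>"
    \<comment> \<open>The smallest \<open>E\<close> for which \<open>\<sigma>\<close> has both ends
      in \<open>E\<close>; it is finite, so (ii) applies.\<close>
    let ?E = "{src G \<sigma>, tgt G \<sigma>}"
    have "src G \<sigma> \<in> identities G" "tgt G \<sigma> \<in> identities G"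
      using \<sigma> cat unfolding identities_iff[OF cat] small_category_def by auto
    then have E: "?E \<subseteq> identities G" by simp
    have "unital (part R (full_on G ?E))" using parts E by simp
    moreover have "\<sigma> \<in> full_on G ?E" using \<sigma> by (simp add: full_on_def)
    ultimately have "unity (R (tgt G \<sigma>)) * x = x \<and> x * unity (R (src G \<sigma>)) = x"
      using local_units_if_parts_unital(2)[OF assms E _ _ x] by blast
    then show "unity (R (tgt G \<sigma>)) * x = x" "x * unity (R (src G \<sigma>)) = x" by simp_all
  qed
qed

end
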